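(* Let $\mathbf G=(V,E)$ be a general (finite, simple) undirected graph with $V=\{1,\dots,n\}$. For $v\in V$, let $E(v)\subset E$ denote the set of edges incident to $v$. Let $\mathbf Z_E=\big(Z_{E(1)},Z_{E(2)},\dots,Z_{E(n)}\big)$ be the vector of vertex monomials, where $Z_{E(v)}=\prod_{uv\in E(v)}z_{uv}$ is a product of the edge indeterminates $\{z_{uv}:uv\in E\}$. Then the graph polynomial of the number of independent sets of $\mathbf G$ is $$\pi_\alpha(z)=\sum_{k=0}^{n}\bigl|e_k^{\mathrm{Nil}}(\mathbf Z_E)\bigr|\,z^k,$$ where $e_k^{\mathrm{Nil}}(\mathbf Z_E)$ denotes the elementary symmetric polynomial $e_k(\mathbf Z_E)$ evaluated for nilpotent edge indeterminates of degree $2$, i.e. $z_{uv}^2=0$ for all $uv\in E$, and where $\bigl|e_k^{\mathrm{Nil}}(\mathbf Z_E)\bigr|$ is the number of monomial terms in $e_k^{\mathrm{Nil}}(\mathbf Z_E)$.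
   Context: An independent set of $\mathbf G$ is a subset of $V$ such that no two vertices in the subset are adjacent; its order is its cardinality. $A_k$ denotes the number of independent sets of order $k\ge 0$, and the graph polynomial of the number of independent sets is the generating function $\pi_\alpha(z)=\sum_{k=0}^{\infty}A_kz^k$ in the indeterminate $z$. One indeterminate $z_{uv}$ is assigned to each edge $uv\in E$. The elementary symmetric polynomials are $e_0(\mathbf Z_E)=1$ and $e_k(\mathbf Z_E)=\sum_{1\le i_1<\cdots<i_k\le n}Z_{E(i_1)}\cdots Z_{E(i_k)}$ for $k\ge 1$. *)

theory Defs
  imports "HOL-Library.Poly_Mapping" "HOL-Computational_Algebra.Polynomial"
begin

definition simple_graph :: "nat \<Rightarrow> nat set set \<Rightarrow> bool" where
  "simple_graph n E \<longleftrightarrow> E \<subseteq> {{u, v} | u v. u \<in> {1..n} \<and> v \<in> {1..n} \<and> u \<noteq> v}"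

definition independent_set :: "nat \<Rightarrow> nat set set \<Rightarrow> nat set \<Rightarrow> bool" where
  "independent_set n E S \<longleftrightarrow> S \<subseteq> {1..n} \<and> (\<forall>u\<in>S. \<forall>v\<in>S. {u, v} \<notin> E)"

definition num_independent :: "nat \<Rightarrow> nat set set \<Rightarrow> nat \<Rightarrow> nat" where
  "num_independent n E k = card {S. independent_set n E S \<and> card S = k}"

definition independence_poly :: "nat \<Rightarrow> nat set set \<Rightarrow> int poly" where
  "independence_poly n E = Abs_poly (\<lambda>k. int (num_independent n E k))"

text \<open>The argument of \<^const>\<open>Abs_poly\<close> above is eventually zero, so that it is indeed the
  coefficient sequence of the polynomial.\<close>

lemma num_independent_eq_0:
  assumes "n < k"
  shows "num_independent n E k = 0"
proof -
  have "card S \<noteq> k" if "independent_set n E S" for S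
    using that assms card_mono[of "{1..n}" S] by (auto simp: independent_set_def)
  then have "{S. independent_set n E S \<and> card S = k} = {}"
    by auto
  then show ?thesis
    by (simp only: num_independent_def card.empty)
qed

lemma coeff_independence_poly:
  "poly.coeff (independence_poly n E) k = int (num_independent n E k)"
  unfolding independence_poly_def
  by (subst Abs_poly_inverse) (auto simp: MOST_nat intro!: exI[of _ n] num_independent_eq_0)

text \<open>A polynomial over the integers maps monomials (finitely supported exponent functions)
  to coefficients; its multiplication is the convolution product of \<^typ>\<open>'a \<Rightarrow>\<^sub>0 'b\<close>.\<close>

type_synonym 'v int_mpoly = "('v \<Rightarrow>\<^sub>0 nat) \<Rightarrow>\<^sub>0 int"

definition indet :: "'v \<Rightarrow> 'v int_mpoly" where
  "indet x = Poly_Mapping.single (Poly_Mapping.single x 1) 1"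

definition elem_sym :: "nat \<Rightarrow> nat \<Rightarrow> (nat \<Rightarrow> 'v int_mpoly) \<Rightarrow> 'v int_mpoly" where
  "elem_sym k n X = (\<Sum>I | I \<subseteq> {1..n} \<and> card I = k. \<Prod>i\<in>I. X i)"

text \<open>The ideal generated by the squares of the indeterminates indexed by \<open>E\<close>: the span of these
  squares in the polynomial ring, considered as a module over itself.\<close>

definition square_ideal :: "'v set \<Rightarrow> 'v int_mpoly set" where
  "square_ideal E = module.span (*) ((\<lambda>x. indet x ^ 2) ` E)"

definition square_reduced :: "'v set \<Rightarrow> 'v int_mpoly \<Rightarrow> bool" where
  "square_reduced E p \<longleftrightarrow>
     (\<forall>m \<in> Poly_Mapping.keys p. \<forall>x\<in>E. Poly_Mapping.lookup m x < 2)"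

text \<open>Evaluating a polynomial at indeterminates subject to the relations \<open>x\<^sup>2 = 0\<close>, for \<open>x\<close> in \<open>E\<close>,
  means passing to the quotient by \<^term>\<open>square_ideal E\<close>. The residue class is represented by its
  unique member in which no monomial contains the square of an indeterminate in \<open>E\<close>; see
  \<open>ex1_square_reduced\<close> and \<open>nil_eval_eq_iff\<close> below.\<close>

definition nil_eval :: "'v set \<Rightarrow> 'v int_mpoly \<Rightarrow> 'v int_mpoly" where
  "nil_eval E p = (THE q. square_reduced E q \<and> p - q \<in> square_ideal E)"

text \<open>Monomial terms are counted with multiplicity, i.e. without collecting equal monomials: the
  polynomial \<open>2xy + z\<close> has three terms. Distinct vertex sets can yield the same monomial: for the
  single edge \<open>{1, 2}\<close>, the first elementary symmetric polynomial is \<open>z + z\<close>, and the two terms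
  correspond to the two independent sets of order 1.\<close>

definition num_terms :: "'v int_mpoly \<Rightarrow> nat" where
  "num_terms p = (\<Sum>m \<in> Poly_Mapping.keys p. nat \<bar>Poly_Mapping.lookup p m\<bar>)"

definition vertex_monomial :: "nat set set \<Rightarrow> nat \<Rightarrow> nat set int_mpoly" where
  "vertex_monomial E v = (\<Prod>e | e \<in> E \<and> v \<in> e. indet e)"

definition elem_sym_nil :: "nat \<Rightarrow> nat \<Rightarrow> nat set set \<Rightarrow> nat set int_mpoly" where
  "elem_sym_nil k n E = nil_eval E (elem_sym k n (vertex_monomial E))"

lemma module_self: "module ((*) :: 'v int_mpoly \<Rightarrow> _)"
  by standard (simp_all add: algebra_simps)

lemma indet_square: "indet x ^ 2 = Poly_Mapping.single (Poly_Mapping.single x 2) 1"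
  by (simp add: indet_def power2_eq_square mult_single numeral_2_eq_2 flip: single_add)

lemma square_ideal_keys:
  fixes p :: "'v int_mpoly"
  assumes "p \<in> square_ideal E" "m \<in> Poly_Mapping.keys p"
  shows "\<exists>x\<in>E. 2 \<le> Poly_Mapping.lookup m x"
proof -
  interpret M: module "(*) :: 'v int_mpoly \<Rightarrow> _" by (rule module_self)
  show ?thesis
    using assms unfolding square_ideal_def
  proof (induction arbitrary: m rule: M.span_induct_alt)
    case base
    then show ?case by simp
  next
    case (step c s p)
    then obtain x where x: "x \<in> E" "s = indet x ^ 2" by auto
    show ?case
    proof (cases "m \<in> Poly_Mapping.keys p")
      case True
      then show ?thesis using step by blast
    next
      case False
      then have "m \<in> Poly_Mapping.keys (c * s)"
        using step.prems Poly_Mapping.keys_add[of "c * s" p] by blast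
      then obtain a where "m = a + Poly_Mapping.single x 2"
        using keys_mult[of c s] x by (auto simp: indet_square)
      then have "2 \<le> Poly_Mapping.lookup m x" by (simp add: lookup_add)
      with x show ?thesis by blast
    qed
  qed
qed

lemma single_in_square_ideal:
  fixes m :: "'v \<Rightarrow>\<^sub>0 nat"
  assumes "x \<in> E" "2 \<le> Poly_Mapping.lookup m x"
  shows "Poly_Mapping.single m c \<in> square_ideal E"
proof -
  interpret M: module "(*) :: 'v int_mpoly \<Rightarrow> _" by (rule module_self)
  have "m = (m - Poly_Mapping.single x 2) + Poly_Mapping.single x 2"
    using assms by (intro poly_mapping_eqI) (auto simp: lookup_add lookup_minus lookup_single when_def)
  then have "Poly_Mapping.single m c =
      Poly_Mapping.single (m - Poly_Mapping.single x 2) c * indet x ^ 2"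
    by (simp add: indet_square mult_single)
  moreover have "indet x ^ 2 \<in> square_ideal E"
    using assms unfolding square_ideal_def by (intro M.span_base imageI)
  ultimately show ?thesis
    unfolding square_ideal_def by (simp only: M.span_scale)
qed

lemma ex1_square_reduced:
  fixes p :: "'v int_mpoly"
  shows "\<exists>!q. square_reduced E q \<and> p - q \<in> square_ideal E"
proof -
  interpret M: module "(*) :: 'v int_mpoly \<Rightarrow> _" by (rule module_self)
  define bad where "bad = {m :: 'v \<Rightarrow>\<^sub>0 nat. \<exists>x\<in>E. 2 \<le> Poly_Mapping.lookup m x}"
  define r where "r = (\<Sum>m \<in> Poly_Mapping.keys p \<inter> bad.
    Poly_Mapping.single m (Poly_Mapping.lookup p m))"
  have r: "r \<in> square_ideal E"
    unfolding r_def square_ideal_def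
    by (rule M.span_sum, fold square_ideal_def) (auto simp: bad_def intro: single_in_square_ideal)
  have lookup_r: "Poly_Mapping.lookup r m = (if m \<in> bad then Poly_Mapping.lookup p m else 0)" for m
    by (auto simp: r_def lookup_sum lookup_single when_def in_keys_iff)
  have "square_reduced E (p - r)"
    by (auto simp: square_reduced_def in_keys_iff lookup_minus lookup_r bad_def not_le
        split: if_splits)
  moreover have "q = q'"
    if "square_reduced E q" "p - q \<in> square_ideal E"
      "square_reduced E q'" "p - q' \<in> square_ideal E" for q q'
  proof -
    have "(p - q') - (p - q) \<in> square_ideal E"
      using that unfolding square_ideal_def by (simp only: M.span_diff)
    then have *: "q - q' \<in> square_ideal E" by simp
    have "m \<notin> Poly_Mapping.keys (q - q')" for m
    proof
      assume m: "m \<in> Poly_Mapping.keys (q - q')"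
      then obtain x where "x \<in> E" "2 \<le> Poly_Mapping.lookup m x"
        using square_ideal_keys[OF *] by blast
      moreover have "m \<in> Poly_Mapping.keys q \<or> m \<in> Poly_Mapping.keys q'"
        using m Poly_Mapping.keys_diff[of q q'] by blast
      ultimately show False
        using that unfolding square_reduced_def by (meson not_le)
    qed
    then have "Poly_Mapping.keys (q - q') = {}" by blast
    then show ?thesis by simp
  qed
  ultimately show ?thesis
    using r by (intro ex1I[of _ "p - r"]) auto
qed

lemma nil_eval_eq_iff: "nil_eval E p = q \<longleftrightarrow> square_reduced E q \<and> p - q \<in> square_ideal E"
  unfolding nil_eval_def using theI'[OF ex1_square_reduced[of E p]] ex1_square_reduced[of E p]
  by blast

end

theory Submission
  imports Defs
begin

text \<open>
  Multiplying the vertex monomials of a vertex set \<open>I\<close> gives a single monomial, in which the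
  indeterminate of an edge \<open>e\<close> has exponent \<open>card (I \<inter> e)\<close>. An edge has two endpoints, so this
  exponent reaches 2 exactly when \<open>I\<close> contains both of them. Hence the monomial of \<open>I\<close> survives
  the relations \<open>z\<^sub>e\<^sup>2 = 0\<close> exactly when \<open>I\<close> is independent
  (\<open>independent_set_iff_degree_less_2\<close>), and reducing \<open>e\<^sub>k\<close> deletes precisely the summands of the
  dependent sets (\<open>nil_eval_sum_monomials\<close>).

  The surviving summands need not be distinct: isolated vertices, for instance, all contribute the
  monomial 1. But every summand has coefficient 1, so collecting equal ones cannot cancel anything,
  and counting terms with multiplicity counts the independent sets of order \<open>k\<close>
  (\<open>num_terms_sum_monomials\<close>).
\<close>

lemma prod_single_one:
  "(\<Prod>i\<in>A. Poly_Mapping.single (f i) (1 :: int)) = Poly_Mapping.single (\<Sum>i\<in>A. f i) 1"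
  by (induction A rule: infinite_finite_induct) (simp_all add: mult_single flip: single_one)

definition set_exponent :: "nat set set \<Rightarrow> nat set \<Rightarrow> (nat set \<Rightarrow>\<^sub>0 nat)" where
  "set_exponent E I = (\<Sum>i\<in>I. \<Sum>e | e \<in> E \<and> i \<in> e. Poly_Mapping.single e 1)"

lemma prod_vertex_monomial:
  "(\<Prod>i\<in>I. vertex_monomial E i) = Poly_Mapping.single (set_exponent E I) 1"
  by (simp add: vertex_monomial_def indet_def prod_single_one set_exponent_def)

lemma lookup_set_exponent:
  assumes "finite E" "finite I" "e \<in> E"
  shows "Poly_Mapping.lookup (set_exponent E I) e = card (I \<inter> e)"
proof -
  have "Poly_Mapping.lookup (set_exponent E I) e = (\<Sum>i\<in>I. if i \<in> e then Suc 0 else 0)"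
    using assms by (simp add: set_exponent_def lookup_sum lookup_single when_def)
  also have "\<dots> = card (I \<inter> e)"
    using assms by (simp add: sum.If_cases Int_def)
  finally show ?thesis .
qed

lemma finite_simple_graph:
  assumes "simple_graph n E"
  shows "finite E"
proof (rule finite_subset)
  show "E \<subseteq> Pow {1..n}"
    using assms by (auto simp: simple_graph_def)
qed simp

text \<open>The equivalence depends on edges having two distinct endpoints: a loop would make its vertex
  dependent while having exponent only 1.\<close>

lemma independent_set_iff_degree_less_2:
  assumes "simple_graph n E" "I \<subseteq> {1..n}"
  shows "independent_set n E I \<longleftrightarrow>
    (\<forall>e\<in>E. Poly_Mapping.lookup (set_exponent E I) e < 2)"
proof -
  have fin: "finite E" "finite I"
    using assms finite_simple_graph finite_subset[of I] by auto
  have edge: "card (I \<inter> {u, v}) < 2 \<longleftrightarrow> \<not> (u \<in> I \<and> v \<in> I)" if "u \<noteq> v" for u v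
    using that by (auto simp: Int_insert_right)
  have edges: "\<exists>u v. e = {u, v} \<and> u \<noteq> v" if "e \<in> E" for e
    using assms(1) that unfolding simple_graph_def by blast
  have "independent_set n E I \<longleftrightarrow> (\<forall>e\<in>E. card (I \<inter> e) < 2)"
    unfolding independent_set_def
  proof (intro iffI conjI ballI)
    fix e assume *: "I \<subseteq> {1..n} \<and> (\<forall>u\<in>I. \<forall>v\<in>I. {u, v} \<notin> E)" "e \<in> E"
    then show "card (I \<inter> e) < 2"
      using edges[of e] edge by blast
  next
    fix u v assume *: "\<forall>e\<in>E. card (I \<inter> e) < 2" "u \<in> I" "v \<in> I"
    show "{u, v} \<notin> E"
    proof
      assume "{u, v} \<in> E"
      moreover from this have "u \<noteq> v"
        using edges[of "{u, v}"] by auto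
      ultimately show False
        using * edge by blast
    qed
  qed (use assms in auto)
  then show ?thesis
    using fin by (simp add: lookup_set_exponent)
qed

text \<open>Reduction acts on each monomial separately: one that contains a square lies in the ideal, and
  a sum of the others is its own reduced representative.\<close>

lemma nil_eval_sum_monomials:
  fixes f :: "'a \<Rightarrow> ('v \<Rightarrow>\<^sub>0 nat)"
  assumes "finite F"
  shows "nil_eval E (\<Sum>I\<in>F. Poly_Mapping.single (f I) 1) =
    (\<Sum>I | I \<in> F \<and> (\<forall>x\<in>E. Poly_Mapping.lookup (f I) x < 2). Poly_Mapping.single (f I) 1)"
    (is "nil_eval E (sum ?s F) = sum ?s ?G")
  unfolding nil_eval_eq_iff
proof
  interpret M: module "(*) :: 'v int_mpoly \<Rightarrow> _" by (rule module_self)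
  have "Poly_Mapping.keys (sum ?s ?G) \<subseteq> (\<Union>I\<in>?G. Poly_Mapping.keys (?s I))"
    by (rule keys_sum)
  then show "square_reduced E (sum ?s ?G)"
    by (fastforce simp: square_reduced_def)
  have "sum ?s F - sum ?s ?G = sum ?s (F - ?G)"
    using assms by (simp add: sum_diff)
  also have "\<dots> \<in> square_ideal E"
    unfolding square_ideal_def
    by (rule M.span_sum, fold square_ideal_def)
      (auto simp: not_less intro: single_in_square_ideal)
  finally show "sum ?s F - sum ?s ?G \<in> square_ideal E" .
qed

lemma num_terms_sum_monomials:
  assumes "finite F"
  shows "num_terms (\<Sum>I\<in>F. Poly_Mapping.single (f I) 1) = card F"
    (is "num_terms ?p = _")
proof -
  have lookup: "Poly_Mapping.lookup ?p m = int (card {I \<in> F. f I = m})" for m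
    using assms by (simp add: lookup_sum lookup_single when_def sum.If_cases Int_def eq_commute)
  have "f ` F \<subseteq> Poly_Mapping.keys ?p"
    using assms by (auto simp: in_keys_iff lookup)
  then have "(\<Sum>m\<in>Poly_Mapping.keys ?p. \<Sum>I | I \<in> F \<and> f I = m. 1) = (\<Sum>I\<in>F. 1 :: nat)"
    using assms by (intro sum.group) auto
  then show ?thesis
    by (simp add: num_terms_def lookup)
qed

lemma num_terms_elem_sym_nil:
  assumes "simple_graph n E"
  shows "num_terms (elem_sym_nil k n E) = num_independent n E k"
proof -
  let ?F = "{I. I \<subseteq> {1..n} \<and> card I = k}"
  let ?G = "{I \<in> ?F. \<forall>e\<in>E. Poly_Mapping.lookup (set_exponent E I) e < 2}"
  have fin: "finite ?F"
    by simp
  have "elem_sym_nil k n E = (\<Sum>I\<in>?G. Poly_Mapping.single (set_exponent E I) 1)"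
    unfolding elem_sym_nil_def elem_sym_def prod_vertex_monomial
    by (rule nil_eval_sum_monomials[OF fin])
  moreover have "finite ?G"
    by simp
  ultimately have "num_terms (elem_sym_nil k n E) = card ?G"
    by (simp only: num_terms_sum_monomials)
  also have "?G = {I. independent_set n E I \<and> card I = k}"
    using independent_set_iff_degree_less_2[OF assms] by (auto simp: independent_set_def)
  finally show ?thesis
    by (simp add: num_independent_def)
qed

theorem theorem1:
  fixes n :: nat and E :: "nat set set"
  assumes "simple_graph n E"
  shows "independence_poly n E = (\<Sum>k=0..n. monom (int (num_terms (elem_sym_nil k n E))) k)"
  by (rule poly_eqI)
    (auto simp: coeff_independence_poly num_terms_elem_sym_nil[OF assms] coeff_sum
      intro: num_independent_eq_0)

end
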